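(* Let $I$ be an open interval in $\mathbb{R}$, let $f: I \to \mathbb{R}$ be a function, and fix a point $x \in I$. Assume that the specular derivative $f^{\mathrm{sd}}(x)$ exists (as a finite real number) and that at least one of the one-sided derivatives $\partial^+f(x)$ and $\partial^-f(x)$ exists as an extended real number. Then both one-sided derivatives exist in $\overline{\mathbb{R}}$, and $$f^{\mathrm{sd}}(x) = \mathcal{B}\left( \partial^+ f(x), \partial^- f(x) \right) = \mathcal{C}\left( \partial^+ f(x), \partial^- f(x) \right).$$ In particular, the common value is a real number.
   Context: Let $\overline{\mathbb{R}} := \mathbb{R}\cup\{-\infty,+\infty\}$. For an open interval $I\subset\mathbb{R}$, a function $f:I\to\mathbb{R}$ and a point $x\in I$, the specular derivative of $f$ at $x$ is $$f^{\mathrm{sd}}(x) := \lim_{h \searrow 0} \mathcal{A}(f(x + h) - f(x), f(x) - f(x - h), h)$$ (with $h>0$ small enough that $x\pm h\in I$), where $\mathcal{A}:\mathbb{R}\times\mathbb{R}\times(0,\infty)\to\mathbb{R}$ is $$\mathcal{A}(a, b, c) := \frac{a \sqrt{b^2 + c^2} + b \sqrt{a^2 + c^2}}{c \sqrt{a^2 + c^2} + c \sqrt{b^2 + c^2}}.$$ The right and left derivatives are $\partial^+ f(x) := \lim_{h\searrow 0}\frac{f(x+h)-f(x)}{h}$ and $\partial^- f(x) := \lim_{h\searrow 0}\frac{f(x)-f(x-h)}{h}$, which may take values in $\overline{\mathbb{R}}$. The function $\mathcal{B}:\overline{\mathbb{R}}^2\to\overline{\mathbb{R}}$ is $\mathcal{B}(\alpha,\beta)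 := \tan\left(\frac12\arctan(\alpha)+\frac12\arctan(\beta)\right)$, with the conventions $\arctan(\pm\infty):=\pm\frac{\pi}{2}$ and $\tan(\pm\frac{\pi}{2}):=\pm\infty$. The function $\mathcal{C}:\overline{\mathbb{R}}^2\to\overline{\mathbb{R}}$ is $$\mathcal{C}(\alpha, \beta) := \begin{cases} \left( \frac{\alpha}{\sqrt{1 + \alpha^2}} + \frac{\beta}{\sqrt{1 + \beta^2}} \right) \left( \frac{1}{\sqrt{1 + \alpha^2}} + \frac{1}{\sqrt{1 + \beta^2}} \right)^{-1} & \text{if } \alpha, \beta \in \mathbb{R},\\ \alpha \pm \sqrt{1 + \alpha^2} & \text{if } \alpha \in \mathbb{R},\ \beta = \pm \infty,\\ \beta \pm \sqrt{1 + \beta^2} & \text{if } \alpha = \pm \infty,\ \beta \in \mathbb{R},\\ 0 & \text{if } (\alpha,\beta)=(\pm\infty,\mp\infty),\\ \pm \infty & \text{if } (\alpha,\beta)=(\pm\infty,\pm\infty). \end{cases}$$ *)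

theory Defs
  imports "HOL-Analysis.Analysis"
begin

definition specular_A :: "real \<Rightarrow> real \<Rightarrow> real \<Rightarrow> real" where
  "specular_A a b c =
     (a * sqrt (b\<^sup>2 + c\<^sup>2) + b * sqrt (a\<^sup>2 + c\<^sup>2)) /
     (c * sqrt (a\<^sup>2 + c\<^sup>2) + c * sqrt (b\<^sup>2 + c\<^sup>2))"

text \<open>
  A function on an open interval \<open>I\<close> is a total function of which only the values on \<open>I\<close> are
  used: every limit below ranges over those \<open>h > 0\<close> for which all evaluation points lie in \<open>I\<close>.
  The limit operator \<^const>\<open>Lim\<close> is total, so each derivative comes with a separate
  predicate stating that it exists. The specular limit is taken in the reals (so existence includes
  finiteness), the one-sided limits in the extended reals.
\<close>

definition has_specular_deriv :: "real set \<Rightarrow> (real \<Rightarrow> real) \<Rightarrow> real \<Rightarrow> real \<Rightarrow> bool" where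
  "has_specular_deriv I f x s \<longleftrightarrow>
     ((\<lambda>h. specular_A (f (x + h) - f x) (f x - f (x - h)) h) \<longlongrightarrow> s)
       (at 0 within {h. 0 < h \<and> x + h \<in> I \<and> x - h \<in> I})"

definition specular_deriv_exists :: "real set \<Rightarrow> (real \<Rightarrow> real) \<Rightarrow> real \<Rightarrow> bool" where
  "specular_deriv_exists I f x \<longleftrightarrow> (\<exists>s. has_specular_deriv I f x s)"

definition specular_deriv :: "real set \<Rightarrow> (real \<Rightarrow> real) \<Rightarrow> real \<Rightarrow> real" where
  "specular_deriv I f x =
     Lim (at 0 within {h. 0 < h \<and> x + h \<in> I \<and> x - h \<in> I})
       (\<lambda>h. specular_A (f (x + h) - f x) (f x - f (x - h)) h)"

definition has_right_deriv :: "real set \<Rightarrow> (real \<Rightarrow> real) \<Rightarrow> real \<Rightarrow> ereal \<Rightarrow> bool" where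
  "has_right_deriv I f x d \<longleftrightarrow>
     ((\<lambda>h. ereal ((f (x + h) - f x) / h)) \<longlongrightarrow> d) (at 0 within {h. 0 < h \<and> x + h \<in> I})"

definition right_deriv_exists :: "real set \<Rightarrow> (real \<Rightarrow> real) \<Rightarrow> real \<Rightarrow> bool" where
  "right_deriv_exists I f x \<longleftrightarrow> (\<exists>d. has_right_deriv I f x d)"

definition right_deriv :: "real set \<Rightarrow> (real \<Rightarrow> real) \<Rightarrow> real \<Rightarrow> ereal" where
  "right_deriv I f x =
     Lim (at 0 within {h. 0 < h \<and> x + h \<in> I}) (\<lambda>h. ereal ((f (x + h) - f x) / h))"

definition has_left_deriv :: "real set \<Rightarrow> (real \<Rightarrow> real) \<Rightarrow> real \<Rightarrow> ereal \<Rightarrow> bool" where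
  "has_left_deriv I f x d \<longleftrightarrow>
     ((\<lambda>h. ereal ((f x - f (x - h)) / h)) \<longlongrightarrow> d) (at 0 within {h. 0 < h \<and> x - h \<in> I})"

definition left_deriv_exists :: "real set \<Rightarrow> (real \<Rightarrow> real) \<Rightarrow> real \<Rightarrow> bool" where
  "left_deriv_exists I f x \<longleftrightarrow> (\<exists>d. has_left_deriv I f x d)"

definition left_deriv :: "real set \<Rightarrow> (real \<Rightarrow> real) \<Rightarrow> real \<Rightarrow> ereal" where
  "left_deriv I f x =
     Lim (at 0 within {h. 0 < h \<and> x - h \<in> I}) (\<lambda>h. ereal ((f x - f (x - h)) / h))"

definition arctan_ext :: "ereal \<Rightarrow> real" where
  "arctan_ext a = (case a of ereal r \<Rightarrow> arctan r | PInfty \<Rightarrow> pi / 2 | MInfty \<Rightarrow> - (pi / 2))"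

text \<open>Intended for angles between \<open>- pi / 2\<close> and \<open>pi / 2\<close>; no other angle occurs below.\<close>

definition tan_ext :: "real \<Rightarrow> ereal" where
  "tan_ext t = (if t = pi / 2 then \<infinity> else if t = - (pi / 2) then - \<infinity> else ereal (tan t))"

definition specular_B :: "ereal \<Rightarrow> ereal \<Rightarrow> ereal" where
  "specular_B a b = tan_ext (1 / 2 * arctan_ext a + 1 / 2 * arctan_ext b)"

definition specular_C :: "ereal \<Rightarrow> ereal \<Rightarrow> ereal" where
  "specular_C a b = (case (a, b) of
       (ereal r, ereal s) \<Rightarrow>
          ereal ((r / sqrt (1 + r\<^sup>2) + s / sqrt (1 + s\<^sup>2)) *
                 inverse (1 / sqrt (1 + r\<^sup>2) + 1 / sqrt (1 + s\<^sup>2)))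
     | (ereal r, PInfty) \<Rightarrow> ereal (r + sqrt (1 + r\<^sup>2))
     | (ereal r, MInfty) \<Rightarrow> ereal (r - sqrt (1 + r\<^sup>2))
     | (PInfty, ereal s) \<Rightarrow> ereal (s + sqrt (1 + s\<^sup>2))
     | (MInfty, ereal s) \<Rightarrow> ereal (s - sqrt (1 + s\<^sup>2))
     | (PInfty, MInfty) \<Rightarrow> 0
     | (MInfty, PInfty) \<Rightarrow> 0
     | (PInfty, PInfty) \<Rightarrow> \<infinity>
     | (MInfty, MInfty) \<Rightarrow> - \<infinity>)"

end

theory Submission
  imports Defs
begin

text \<open>
  The function \<open>arctan_ext\<close> is an order isomorphism, hence a homeomorphism, from the extended reals
  onto \<open>[- pi / 2, pi / 2]\<close>. In the angle coordinate that it provides, \<open>specular_B\<close> is the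
  arithmetic mean. The half-angle formula \<open>tan ((u + v) / 2) = (sin u + sin v) / (cos u + cos v)\<close>
  shows that \<open>specular_C\<close> is the same function (lemma \<open>specular_B_eq_specular_C\<close>), and
  \<open>specular_A a b c\<close> is \<open>specular_C\<close> at the quotients \<open>a / c\<close> and \<open>b / c\<close>.

  So the specular difference quotient is, in angles, the mean of the angles of the two one-sided
  difference quotients. If the mean converges and one of the two angles converges, the other angle
  converges as well, being twice the mean minus the first. Its limit stays in the compact interval
  \<open>[- pi / 2, pi / 2]\<close>, so it is the angle of an extended real, which is the missing one-sided
  derivative (lemma \<open>tendsto_of_tendsto_specular_B\<close>). The mean of the two limit angles is the angle
  of the specular derivative, which is the asserted formula.
\<close>

section \<open>The extended arctangent as a homeomorphism\<close>

lemma arctan_ext_simps [simp]: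
  "arctan_ext (ereal r) = arctan r"
  "arctan_ext \<infinity> = pi / 2"
  "arctan_ext (- \<infinity>) = - (pi / 2)"
  by (simp_all add: arctan_ext_def)

lemma arctan_ext_bounds: "- (pi / 2) \<le> arctan_ext a" "arctan_ext a \<le> pi / 2"
  using arctan_lbound arctan_ubound by (cases a; simp add: less_imp_le)+

lemma arctan_ext_tan_ext:
  assumes "- (pi / 2) \<le> t" "t \<le> pi / 2"
  shows "arctan_ext (tan_ext t) = t"
  using assms by (auto simp: tan_ext_def arctan_tan)

lemma arctan_ext_less_iff: "arctan_ext a < arctan_ext b \<longleftrightarrow> a < b"
proof -
  have "\<not> pi / 2 < arctan r" "\<not> arctan r < - (pi / 2)" for r
    using arctan_lbound[of r] arctan_ubound[of r] by linarith+
  then show ?thesis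
    using arctan_lbound arctan_ubound pi_gt_zero
    by (cases a; cases b; simp add: arctan_less_iff)
qed

lemma arctan_ext_eq_iff: "arctan_ext a = arctan_ext b \<longleftrightarrow> a = b"
  by (metis arctan_ext_less_iff less_irrefl linorder_less_linear)

text \<open>
  Strict monotonicity alone carries order bounds on \<open>arctan_ext (g h)\<close> back to \<open>g h\<close>; the converse needs
  that every bound in \<open>[- pi / 2, pi / 2]\<close> is itself a value of \<open>arctan_ext\<close>. Bounds outside that
  interval hold everywhere.
\<close>

lemma tendsto_arctan_ext_iff:
  "((\<lambda>h. arctan_ext (g h)) \<longlongrightarrow> arctan_ext d) F \<longleftrightarrow> (g \<longlongrightarrow> d) F"
proof
  assume lim: "((\<lambda>h. arctan_ext (g h)) \<longlongrightarrow> arctan_ext d) F"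
  show "(g \<longlongrightarrow> d) F"
    using order_tendstoD[OF lim] by (intro order_tendstoI) (simp_all flip: arctan_ext_less_iff)
next
  assume lim: "(g \<longlongrightarrow> d) F"
  show "((\<lambda>h. arctan_ext (g h)) \<longlongrightarrow> arctan_ext d) F"
  proof (rule order_tendstoI)
    fix y assume y: "y < arctan_ext d"
    show "\<forall>\<^sub>F h in F. y < arctan_ext (g h)"
    proof (cases "y < - (pi / 2)")
      case True
      then show ?thesis
        using arctan_ext_bounds(1) by (intro always_eventually) (metis less_le_trans)
    next
      case False
      then have "arctan_ext (tan_ext y) = y"
        using y arctan_ext_bounds(2)[of d] by (intro arctan_ext_tan_ext) auto
      then show ?thesis
        using order_tendstoD(1)[OF lim, of "tan_ext y"] y by (simp flip: arctan_ext_less_iff)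
    qed
  next
    fix y assume y: "arctan_ext d < y"
    show "\<forall>\<^sub>F h in F. arctan_ext (g h) < y"
    proof (cases "pi / 2 < y")
      case True
      then show ?thesis
        using arctan_ext_bounds(2) by (intro always_eventually) (metis le_less_trans)
    next
      case False
      then have "arctan_ext (tan_ext y) = y"
        using y arctan_ext_bounds(1)[of d] by (intro arctan_ext_tan_ext) auto
      then show ?thesis
        using order_tendstoD(2)[OF lim, of "tan_ext y"] y by (simp flip: arctan_ext_less_iff)
    qed
  qed
qed

section \<open>The three specular functions\<close>

lemma arctan_ext_specular_B:
  "arctan_ext (specular_B a b) = (arctan_ext a + arctan_ext b) / 2"
proof -
  have "arctan_ext (tan_ext ((arctan_ext a + arctan_ext b) / 2)) = (arctan_ext a + arctan_ext b) / 2"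
    using arctan_ext_bounds[of a] arctan_ext_bounds[of b] by (intro arctan_ext_tan_ext) (simp_all add: field_simps)
  then show ?thesis
    by (simp add: specular_B_def add_divide_distrib)
qed

lemma specular_B_commute: "specular_B a b = specular_B b a"
  by (simp add: specular_B_def add.commute)

lemma tan_half_sum:
  fixes u v :: real
  assumes "cos ((u - v) / 2) \<noteq> 0"
  shows "tan ((u + v) / 2) = (sin u + sin v) / (cos u + cos v)"
  using assms by (simp add: sin_plus_sin cos_plus_cos tan_def)

text \<open>
  The half-angle formula applies as soon as one of the two angles is interior: then the half
  difference lies strictly between \<open>- pi / 2\<close> and \<open>pi / 2\<close>, so its cosine does not vanish, and
  so does the half sum, so \<open>tan_ext\<close> is the ordinary tangent there. The first fails for opposite
  infinities, the second for equal ones.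
\<close>

lemma specular_B_ereal_left:
  "specular_B (ereal r) b =
     ereal ((sin (arctan r) + sin (arctan_ext b)) / (cos (arctan r) + cos (arctan_ext b)))"
proof -
  have bounds: "- (pi / 2) < arctan r" "arctan r < pi / 2"
    "- (pi / 2) \<le> arctan_ext b" "arctan_ext b \<le> pi / 2"
    using arctan_lbound arctan_ubound arctan_ext_bounds by blast+
  then have "cos ((arctan r - arctan_ext b) / 2) > 0"
    by (intro cos_gt_zero_pi) (simp_all add: field_simps)
  then have "tan ((arctan r + arctan_ext b) / 2) =
      (sin (arctan r) + sin (arctan_ext b)) / (cos (arctan r) + cos (arctan_ext b))"
    by (intro tan_half_sum) simp
  moreover have "specular_B (ereal r) b = ereal (tan ((arctan r + arctan_ext b) / 2))"
    using bounds by (auto simp: specular_B_def tan_ext_def add_divide_distrib)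
  ultimately show ?thesis by simp
qed

lemma specular_C_commute: "specular_C a b = specular_C b a"
  by (cases a; cases b; simp add: specular_C_def add.commute)

lemma specular_B_eq_specular_C: "specular_B a b = specular_C a b"
proof -
  have real_left: "specular_B (ereal r) c = specular_C (ereal r) c" for r c
  proof -
    have "0 < sqrt (1 + r\<^sup>2)" by (simp add: add_pos_nonneg)
    then show ?thesis
      by (cases c)
        (simp_all add: specular_B_ereal_left specular_C_def sin_arctan cos_arctan field_simps)
  qed
  show ?thesis
  proof (cases "\<exists>r. a = ereal r \<or> b = ereal r")
    case True
    then show ?thesis
      using real_left by (metis specular_B_commute specular_C_commute)
  next
    case False
    then show ?thesis
      by (cases a; cases b) (auto simp: specular_B_def specular_C_def tan_ext_def)
  qed
qed

lemma specular_A_eq_specular_B: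
  assumes "0 < c"
  shows "ereal (specular_A a b c) = specular_B (ereal (a / c)) (ereal (b / c))"
proof -
  define p q where "p = a / c" and "q = b / c"
  have ab: "a = c * p" "b = c * q"
    using assms by (simp_all add: p_def q_def)
  have root: "sqrt ((c * t)\<^sup>2 + c\<^sup>2) = c * sqrt (1 + t\<^sup>2)" for t
  proof -
    have "(c * t)\<^sup>2 + c\<^sup>2 = c\<^sup>2 * (1 + t\<^sup>2)" by algebra
    then show ?thesis using assms by (simp add: real_sqrt_mult)
  qed
  define P Q where "P = sqrt (1 + p\<^sup>2)" and "Q = sqrt (1 + q\<^sup>2)"
  have pos: "0 < P" "0 < Q" by (simp_all add: P_def Q_def add_pos_nonneg)
  have "specular_A a b c = (c\<^sup>2 * (p * Q + q * P)) / (c\<^sup>2 * (P + Q))"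
    unfolding specular_A_def ab root P_def Q_def by (simp add: power2_eq_square algebra_simps)
  also have "\<dots> = (p * Q + q * P) / (P + Q)"
    using assms by simp
  also have "\<dots> = (p / P + q / Q) * inverse (1 / P + 1 / Q)"
  proof -
    have "p / P + q / Q = (p * Q + q * P) / (P * Q)" "1 / P + 1 / Q = (P + Q) / (P * Q)"
      using pos by (simp_all add: field_simps)
    then show ?thesis using pos by simp
  qed
  finally show ?thesis
    by (simp add: specular_B_eq_specular_C specular_C_def P_def Q_def p_def q_def)
qed

section \<open>Recovering one derivative from the other\<close>

text \<open>
  Of the three quantities \<open>p\<close>, \<open>q\<close> and \<open>specular_B p q\<close>, the convergence of two forces that of the
  third, because the angle of the last is the mean of the angles of the first two.
\<close>

lemma tendsto_of_tendsto_specular_B: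
  assumes "F \<noteq> bot"
    and mean: "((\<lambda>h. specular_B (p h) (q h)) \<longlongrightarrow> m) F"
    and p: "(p \<longlongrightarrow> d) F"
  obtains e where "(q \<longlongrightarrow> e) F" and "specular_B d e = m"
proof -
  define t where "t = 2 * arctan_ext m - arctan_ext d"
  have "((\<lambda>h. 2 * arctan_ext (specular_B (p h) (q h)) - arctan_ext (p h)) \<longlongrightarrow> t) F"
    unfolding t_def using mean p
    by (intro tendsto_intros) (simp_all add: tendsto_arctan_ext_iff)
  then have lim: "((\<lambda>h. arctan_ext (q h)) \<longlongrightarrow> t) F"
    by (simp add: arctan_ext_specular_B add_divide_distrib)
  have "- (pi / 2) \<le> t"
    using lim by (rule tendsto_lowerbound) (intro always_eventually allI arctan_ext_bounds assms(1))+
  moreover have "t \<le> pi / 2"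
    using lim by (rule tendsto_upperbound) (intro always_eventually allI arctan_ext_bounds assms(1))+
  ultimately have t: "arctan_ext (tan_ext t) = t"
    by (rule arctan_ext_tan_ext)
  have "(q \<longlongrightarrow> tan_ext t) F"
    using lim t by (metis tendsto_arctan_ext_iff)
  moreover have "specular_B d (tan_ext t) = m"
    unfolding arctan_ext_eq_iff[symmetric] arctan_ext_specular_B t by (simp add: t_def)
  ultimately show thesis by (rule that)
qed

text \<open>
  All the limits in the definitions are limits along \<open>at_right 0\<close>, since near \<open>0\<close> the evaluation
  points lie in \<open>I\<close> automatically.
\<close>

lemma at_within_positive_nhd:
  fixes U :: "real set"
  assumes "open U" "0 \<in> U"
  shows "at 0 within {h. 0 < h \<and> h \<in> U} = at_right 0"
  using assms by (intro at_within_nhd[of 0 U]) auto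

theorem theorem2p14:
  fixes I :: "real set" and f :: "real \<Rightarrow> real" and x :: real
  assumes "open I" and "is_interval I" and "x \<in> I"
    and "specular_deriv_exists I f x"
    and "right_deriv_exists I f x \<or> left_deriv_exists I f x"
  shows "right_deriv_exists I f x \<and> left_deriv_exists I f x \<and>
    ereal (specular_deriv I f x) = specular_B (right_deriv I f x) (left_deriv I f x) \<and>
    specular_B (right_deriv I f x) (left_deriv I f x) =
      specular_C (right_deriv I f x) (left_deriv I f x) \<and>
    specular_C (right_deriv I f x) (left_deriv I f x) \<in> range ereal"
proof -
  define p where "p = (\<lambda>h. ereal ((f (x + h) - f x) / h))"
  define q where "q = (\<lambda>h. ereal ((f x - f (x - h)) / h))"
  define A where "A = (\<lambda>h. specular_A (f (x + h) - f x) (f x - f (x - h)) h)"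

  have "open ((+) x -` I)" "open ((-) x -` I)"
    using \<open>open I\<close> by (intro open_vimage continuous_intros; simp)+
  then have filters:
    "at 0 within {h. 0 < h \<and> x + h \<in> I} = at_right 0"
    "at 0 within {h. 0 < h \<and> x - h \<in> I} = at_right 0"
    "at 0 within {h. 0 < h \<and> x + h \<in> I \<and> x - h \<in> I} = at_right 0"
    using at_within_positive_nhd[of "(+) x -` I"] at_within_positive_nhd[of "(-) x -` I"]
      at_within_positive_nhd[of "(+) x -` I \<inter> (-) x -` I"] \<open>x \<in> I\<close>
    by (simp_all add: open_Int)

  have right: "has_right_deriv I f x d \<longleftrightarrow> (p \<longlongrightarrow> d) (at_right 0)" for d
    by (simp add: has_right_deriv_def filters p_def)
  have left: "has_left_deriv I f x d \<longleftrightarrow> (q \<longlongrightarrow> d) (at_right 0)" for d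
    by (simp add: has_left_deriv_def filters q_def)

  obtain s where s: "(A \<longlongrightarrow> s) (at_right 0)"
    using assms(4) by (auto simp: specular_deriv_exists_def has_specular_deriv_def filters A_def)
  have "\<forall>\<^sub>F h in at_right 0. ereal (A h) = specular_B (p h) (q h)"
    using eventually_at_right_less
    by (rule eventually_mono) (simp add: A_def p_def q_def specular_A_eq_specular_B)
  then have mean: "((\<lambda>h. specular_B (p h) (q h)) \<longlongrightarrow> ereal s) (at_right 0)"
    by (rule Lim_transform_eventually[OF tendsto_ereal[OF s]])

  obtain d e where d: "(p \<longlongrightarrow> d) (at_right 0)" and e: "(q \<longlongrightarrow> e) (at_right 0)"
    and s_eq: "specular_B d e = ereal s"
    using assms(5)
  proof
    assume "right_deriv_exists I f x"
    then obtain d where d: "(p \<longlongrightarrow> d) (at_right 0)"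
      by (auto simp: right_deriv_exists_def right)
    then obtain e where "(q \<longlongrightarrow> e) (at_right 0)" "specular_B d e = ereal s"
      by (rule tendsto_of_tendsto_specular_B[OF trivial_limit_at_right_real mean])
    then show thesis
      using d by (intro that)
  next
    assume "left_deriv_exists I f x"
    then obtain e where e: "(q \<longlongrightarrow> e) (at_right 0)"
      by (auto simp: left_deriv_exists_def left)
    have "((\<lambda>h. specular_B (q h) (p h)) \<longlongrightarrow> ereal s) (at_right 0)"
      using mean by (subst specular_B_commute)
    then obtain d where "(p \<longlongrightarrow> d) (at_right 0)" "specular_B e d = ereal s"
      using e by (rule tendsto_of_tendsto_specular_B[OF trivial_limit_at_right_real])
    then show thesis
      using e by (metis that specular_B_commute)
  qed

  have "right_deriv I f x = d" "left_deriv I f x = e" "specular_deriv I f x = s"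
    using d e s
    by (simp_all add: right_deriv_def left_deriv_def specular_deriv_def filters
        p_def q_def A_def tendsto_Lim)
  moreover have "right_deriv_exists I f x" "left_deriv_exists I f x"
    using d e by (auto simp: right_deriv_exists_def left_deriv_exists_def right left)
  ultimately show ?thesis
    using s_eq by (simp flip: specular_B_eq_specular_C)
qed

end
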